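(* Let $X$ be a partially ordered vector space that is directed and Archimedean. Then each net catching element of $X$ is an order unit.
   Context: A partially ordered vector space is a real vector space $X$ with a partial order $\leq$ such that $x\leq y$ implies $x+z\leq y+z$ and $\lambda x\leq\lambda y$ for all $z\in X$ and real $\lambda\geq 0$; $X_+=\{x\in X;\ x\geq 0\}$. $X$ is directed if any two elements have a common upper bound (equivalently $X=X_+-X_+$). $X$ is Archimedean if for all $x,y\in X$ with $nx\leq y$ for all $n\in\mathbb{N}$ one has $x\leq 0$. For a net $(x_\alpha)_{\alpha\in A}$ in $X$ we write $x_\alpha\downarrow 0$ if the net is decreasing ($\alpha\leq\beta$ implies $x_\beta\leq x_\alpha$) and $\inf_{\alpha\in A} x_\alpha=0$. An element $y\in X$ is called net catching if for every net $(x_\alpha)_{\alpha\in A}$ in $X$ with $x_\alpha\downarrow 0$ there is $\alpha\in A$ with $x_\alpha\leq y$. An element $u\in X_+$ is an order unit if for every $x\in X$ there is $n\in\mathbb{N}$ with $x\leq nu$. *)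

theory Defs
  imports Complex_Main "HOL-Library.Lub_Glb"
begin

(* Partially ordered vector spaces are the types of class ordered_real_vector; the axiom
   scaleR_right_mono of that class follows from its other axioms, so it restricts nothing. *)

class directed_ordered_real_vector = ordered_real_vector +
  assumes directed: "\<exists>z. x \<le> z \<and> y \<le> z"

(* Here and in order_unit the number n ranges over all of nat; starting from 1 would give
   equivalent notions. *)

class archimedean_ordered_real_vector = ordered_real_vector +
  assumes archimedean: "(\<And>n::nat. real n *\<^sub>R x \<le> y) \<Longrightarrow> x \<le> 0"

definition directed_index :: "'i set \<Rightarrow> 'i rel \<Rightarrow> bool" where
  "directed_index A r \<longleftrightarrow>
     A \<noteq> {} \<and> preorder_on A r \<and> (\<forall>\<alpha>\<in>A. \<forall>\<beta>\<in>A. \<exists>\<gamma>\<in>A. (\<alpha>, \<gamma>) \<in> r \<and> (\<beta>, \<gamma>) \<in> r)"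

(* The net is the restriction of x to A. *)

definition net_decreasing_to_0 ::
    "'i set \<Rightarrow> 'i rel \<Rightarrow> ('i \<Rightarrow> 'a::ordered_real_vector) \<Rightarrow> bool" where
  "net_decreasing_to_0 A r x \<longleftrightarrow>
     (\<forall>\<alpha>\<in>A. \<forall>\<beta>\<in>A. (\<alpha>, \<beta>) \<in> r \<longrightarrow> x \<beta> \<le> x \<alpha>) \<and> isGlb UNIV (x ` A) 0"

(* A definition cannot quantify over the type of the indices, so the index sets here are sets
   of elements of the space itself.  By net_catchingD below this loses no nets. *)

definition net_catching :: "'a::ordered_real_vector \<Rightarrow> bool" where
  "net_catching y \<longleftrightarrow>
     (\<forall>(A :: 'a set) r x.
        directed_index A r \<longrightarrow> net_decreasing_to_0 A r x \<longrightarrow> (\<exists>\<alpha>\<in>A. x \<alpha> \<le> y))"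

definition order_unit :: "'a::ordered_real_vector \<Rightarrow> bool" where
  "order_unit u \<longleftrightarrow> 0 \<le> u \<and> (\<forall>x. \<exists>n::nat. x \<le> real n *\<^sub>R u)"

lemma net_catchingD:
  fixes A :: "'i set" and x :: "'i \<Rightarrow> 'a::ordered_real_vector"
  assumes y: "net_catching y"
    and dir: "directed_index A r"
    and dec: "net_decreasing_to_0 A r x"
  shows "\<exists>\<alpha>\<in>A. x \<alpha> \<le> y"
proof -
  define s where "s = {(a, b). a \<in> x ` A \<and> b \<in> x ` A \<and> b \<le> a}"
  have "preorder_on (x ` A) s"
    unfolding preorder_on_def refl_on_def trans_def s_def by auto
  moreover have "\<exists>c\<in>x ` A. (a, c) \<in> s \<and> (b, c) \<in> s" if mem: "a \<in> x ` A" "b \<in> x ` A" for a b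
  proof -
    obtain \<alpha> \<beta> where ab: "\<alpha> \<in> A" "\<beta> \<in> A" "a = x \<alpha>" "b = x \<beta>"
      using mem by blast
    then obtain \<gamma> where "\<gamma> \<in> A" "(\<alpha>, \<gamma>) \<in> r" "(\<beta>, \<gamma>) \<in> r"
      using dir unfolding directed_index_def by blast
    then show ?thesis
      using ab dec unfolding net_decreasing_to_0_def s_def by auto
  qed
  ultimately have "directed_index (x ` A) s"
    using dir unfolding directed_index_def by blast
  moreover have "net_decreasing_to_0 (x ` A) s id"
    using dec unfolding net_decreasing_to_0_def s_def by auto
  ultimately show ?thesis
    using y unfolding net_catching_def by fastforce
qed

end

theory Submission
  imports Defs
begin

text \<open>For \<open>0 \<le> v\<close> the sequence v/(n+1) decreases to 0: a lower bound z
  satisfies nz \<le> v for all n, so z \<le> 0 by the Archimedean property. A net catching y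
  therefore lies above some v/(n+1), that is, v \<le> (n+1)y. Since the space is directed, every x
  lies below some such v, which makes y an order unit.\<close>

lemma isGlb_inverse_Suc_scaleR:
  fixes v :: "'a::archimedean_ordered_real_vector"
  assumes "0 \<le> v"
  shows "isGlb UNIV (range (\<lambda>n. inverse (real (Suc n)) *\<^sub>R v)) 0"
proof -
  have "z \<le> 0" if z: "\<And>n. z \<le> inverse (real (Suc n)) *\<^sub>R v" for z
  proof (rule archimedean)
    show "real n *\<^sub>R z \<le> v" for n
    \<comment> \<open>\<open>archimedean\<close> also asks for n = 0, where the bound is just
      \<open>0 \<le> v\<close>; for n = m + 1 the m-th term of the sequence is v/n.\<close>
    proof (cases n)
      case 0
      then show ?thesis using assms by simp
    next
      case (Suc m)
      have "real n *\<^sub>R z \<le> real n *\<^sub>R (inverse (real (Suc m)) *\<^sub>R v)"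
        by (intro scaleR_left_mono z) simp
      then show ?thesis using Suc by simp
    qed
  qed
  moreover have "0 \<le> inverse (real (Suc n)) *\<^sub>R v" for n
    using assms by (intro scaleR_nonneg_nonneg) auto
  ultimately show ?thesis
    unfolding isGlb_def greatestP_def isLb_def setge_def setle_def by auto
qed

text \<open>The sequence is a net indexed by \<open>nat\<close> rather than by elements of the
  space, so \<open>net_catchingD\<close> is what makes y catch it.\<close>

lemma net_catching_inverse_Suc_scaleR:
  fixes y v :: "'a::archimedean_ordered_real_vector"
  assumes "net_catching y" and "0 \<le> v"
  shows "\<exists>n. inverse (real (Suc n)) *\<^sub>R v \<le> y"
proof -
  have "directed_index UNIV {(m::nat, n). m \<le> n}"
    unfolding directed_index_def preorder_on_def refl_on_def trans_def
    by (auto intro: max.cobounded1 max.cobounded2)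
  moreover have "net_decreasing_to_0 UNIV {(m::nat, n). m \<le> n}
      (\<lambda>n. inverse (real (Suc n)) *\<^sub>R v)"
    unfolding net_decreasing_to_0_def
    using isGlb_inverse_Suc_scaleR[OF assms(2)] assms(2)
    by (auto intro!: scaleR_right_mono le_imp_inverse_le simp del: of_nat_Suc)
  ultimately show ?thesis
    using net_catchingD[OF assms(1)] by blast
qed

theorem proposition3p4:
  fixes y :: "'a::{directed_ordered_real_vector, archimedean_ordered_real_vector}"
  assumes "net_catching y"
  shows "order_unit y"
proof -
  \<comment> \<open>\<open>order_refl\<close> forces v = 0: the constant net 0 is caught by
    y.\<close>
  have "0 \<le> y"
    using net_catching_inverse_Suc_scaleR[OF assms order_refl] by simp
  moreover have "\<exists>n::nat. x \<le> real n *\<^sub>R y" for x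
  proof -
    \<comment> \<open>A common upper bound of x and 0 replaces x by a positive element, as the
      sequence requires.\<close>
    obtain v where v: "x \<le> v" "0 \<le> v"
      using directed by blast
    obtain n where "inverse (real (Suc n)) *\<^sub>R v \<le> y"
      using net_catching_inverse_Suc_scaleR[OF assms v(2)] by blast
    then have "real (Suc n) *\<^sub>R (inverse (real (Suc n)) *\<^sub>R v) \<le> real (Suc n) *\<^sub>R y"
      by (intro scaleR_left_mono) auto
    then have "v \<le> real (Suc n) *\<^sub>R y"
      by (simp del: of_nat_Suc)
    then show ?thesis
      using v(1) order_trans by blast
  qed
  ultimately show ?thesis
    unfolding order_unit_def by blast
qed

end
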